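(* Let $d\ge 1$ be an integer. As a function of the variables $x_1,\dots,x_d$, the continuous multinomial satisfies the partial differential equation $$\prod_{j=1}^d \left(1+\frac{\partial}{\partial x_j}\right) \begin{Bmatrix} x_1+\dots+x_d \\ x_1\ ,\ \dots\ ,\ x_d \end{Bmatrix} = \sum_{i=1}^d\ \prod_{\substack{1\le j\le d\\ j \neq i}} \left(1+\frac{\partial}{\partial x_j}\right) \begin{Bmatrix} x_1+\dots+x_d \\ x_1\ ,\ \dots\ ,\ x_d \end{Bmatrix}.$$
   Context: Smirnov words: for integers $n\ge 0$, $d\ge 1$, $D(n,d)$ denotes the (finite) set of words $\mathbf c=(c_1,\dots,c_n)$ of length $n$ in the alphabet $\{1,\dots,d\}$ with no two equal consecutive letters. The frequency vector of $\mathbf c$ is $\nu=\nu(\mathbf c)=(\nu_1,\dots,\nu_d)\in\mathbb{Z}_{\ge 0}^d$, where $\nu_i$ is the number of occurrences of the letter $i$ in $\mathbf c$ (so $\nu_1+\dots+\nu_d=n$). Continuous multinomial: as a function of the real variables $x_1,\dots,x_d$, $$\begin{Bmatrix} x_1+\dots+x_d \\ x_1\ ,\ \dots\ ,\ x_d \end{Bmatrix} := \sum_{n=0}^{\infty}\ \sum_{\mathbf c \in D(n,d)} \frac{x_1^{\nu_1-1}}{(\nu_1-1)!} \cdots \frac{x_d^{\nu_d-1}}{(\nu_d-1)!},$$ where $\nu=\nu(\mathbf c)$, with the convention that a factor $\frac{x_i^{\nu_i-1}}{(\nu_i-1)!}$ with $\nu_i=0$ is $0$ (so only words using every letter contribute),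 and $x^0=1$. The products denote compositions of the (commuting) differential operators $1+\frac{\partial}{\partial x_j}$; an empty product is the identity operator. *)

theory Defs
  imports "HOL-Analysis.Analysis"
begin

text \<open>
  The dimension \<open>d\<close> is an explicit natural number. A point of real \<open>d\<close>-space is a function
  \<open>x :: nat \<Rightarrow> real\<close> of which only the coordinates \<open>x 1, \<dots>, x d\<close> are used.
\<close>

definition smirnov_words :: "nat \<Rightarrow> nat \<Rightarrow> nat list set" where
  "smirnov_words n d = {c. length c = n \<and> set c \<subseteq> {1..d} \<and> distinct_adj c}"

text \<open>The factor \<open>t\<^sup>k\<^sup>-\<^sup>1 / (k-1)!\<close>, read as \<open>0\<close> for \<open>k = 0\<close>; here \<open>t ^ 0 = 1\<close> also for \<open>t = 0\<close>.\<close>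

definition cm_factor :: "real \<Rightarrow> nat \<Rightarrow> real" where
  "cm_factor t k = (if k = 0 then 0 else t ^ (k - 1) / fact (k - 1))"

definition cm_level :: "nat \<Rightarrow> (nat \<Rightarrow> real) \<Rightarrow> nat \<Rightarrow> real" where
  "cm_level d x n = (\<Sum>c\<in>smirnov_words n d. \<Prod>i=1..d. cm_factor (x i) (count_list c i))"

definition continuous_multinomial :: "nat \<Rightarrow> (nat \<Rightarrow> real) \<Rightarrow> real" where
  "continuous_multinomial d x = (\<Sum>n. cm_level d x n)"

definition partially_differentiable :: "nat \<Rightarrow> ((nat \<Rightarrow> real) \<Rightarrow> real) \<Rightarrow> bool" where
  "partially_differentiable j F \<longleftrightarrow>
     (\<forall>x. (\<lambda>t. F (x(j := t))) field_differentiable at (x j))"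

definition partial_deriv :: "nat \<Rightarrow> ((nat \<Rightarrow> real) \<Rightarrow> real) \<Rightarrow> (nat \<Rightarrow> real) \<Rightarrow> real" where
  "partial_deriv j F x = deriv (\<lambda>t. F (x(j := t))) (x j)"

definition one_plus_partial :: "nat \<Rightarrow> ((nat \<Rightarrow> real) \<Rightarrow> real) \<Rightarrow> (nat \<Rightarrow> real) \<Rightarrow> real" where
  "one_plus_partial j F = (\<lambda>x. F x + partial_deriv j F x)"

text \<open>
  The composition of the operators \<open>1 + \<partial>/\<partial>x\<^sub>j\<close> for \<open>j \<in> J\<close> (\<open>J\<close> finite), written from left to right
  in increasing order of \<open>j\<close>, so that the operator with the largest index is applied first.
  An order has to be chosen because these operators need not commute on arbitrary functions.
\<close>

definition prod_one_plus_partial ::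
    "nat set \<Rightarrow> ((nat \<Rightarrow> real) \<Rightarrow> real) \<Rightarrow> (nat \<Rightarrow> real) \<Rightarrow> real" where
  "prod_one_plus_partial J F = foldr one_plus_partial (sorted_list_of_set J) F"

end

theory Submission
  imports Defs
begin

text \<open>
  Group the words by their first letter and let \<open>F\<^sub>i\<close> be the part of the continuous multinomial
  \<open>F\<close> that comes from the words beginning with \<open>i\<close>. Differentiating the monomial of a word with
  respect to \<open>x\<^sub>i\<close> lowers the exponent belonging to \<open>i\<close> by one, which is the effect of deleting one
  letter \<open>i\<close>. Deleting the initial letter is a bijection from the Smirnov words that begin with \<open>i\<close>
  onto those that do not, so \<open>\<partial>F\<^sub>i/\<partial>x\<^sub>i = F - F\<^sub>i\<close>, that is, \<open>(1 + \<partial>/\<partial>x\<^sub>i) F\<^sub>i = F\<close>. As the empty word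
  contributes \<open>0\<close>, also \<open>F = \<Sum>\<^sub>i F\<^sub>i\<close>, and hence
  \<open>\<Prod>\<^sub>j (1 + \<partial>/\<partial>x\<^sub>j) F = \<Sum>\<^sub>i \<Prod>\<^sub>j\<^sub>\<noteq>\<^sub>i (1 + \<partial>/\<partial>x\<^sub>j) (1 + \<partial>/\<partial>x\<^sub>i) F\<^sub>i = \<Sum>\<^sub>i \<Prod>\<^sub>j\<^sub>\<noteq>\<^sub>i (1 + \<partial>/\<partial>x\<^sub>j) F\<close>.

  Differentiation under the infinite sum and the interchange of the operators are both obtained from
  one family of series: \<open>word_series d V S\<close> is the formal mixed derivative, once in each variable
  \<open>x\<^sub>i\<close> with \<open>i \<in> S\<close>, of the sum of the monomials of the words in \<open>V\<close>. Its \<open>n\<close>-th level is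
  \<open>O(2\<^sup>-\<^sup>n)\<close> on every bounded set (\<open>word_level_bound\<close>), so the termwise derivatives are the actual
  ones (\<open>has_field_derivative_word_series\<close>), and a product of operators over \<open>J\<close> expands into the sum
  of \<open>word_series d V S\<close> over all \<open>S \<subseteq> J\<close>. This expansion does not depend on the order of the
  operators. The relation between \<open>F\<close> and \<open>F\<^sub>i\<close> is \<open>word_series_starting_with\<close>.
\<close>

section \<open>Series of words and their formal derivatives\<close>

text \<open>
  Since \<open>cm_factor t k\<close> has the derivative \<open>cm_factor t (k - 1)\<close>, lowering the count of every letter
  in \<open>S\<close> by one is the mixed derivative in the variables indexed by \<open>S\<close>. Truncated subtraction at
  count \<open>0\<close> is harmless, as the factor is then \<open>0\<close> anyway.
\<close>

definition word_monomial :: "nat \<Rightarrow> nat set \<Rightarrow> (nat \<Rightarrow> real) \<Rightarrow> nat list \<Rightarrow> real" where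
  "word_monomial d S x c = (\<Prod>i=1..d. cm_factor (x i) (count_list c i - of_bool (i \<in> S)))"

definition word_level ::
    "nat \<Rightarrow> nat list set \<Rightarrow> nat set \<Rightarrow> (nat \<Rightarrow> real) \<Rightarrow> nat \<Rightarrow> real" where
  "word_level d V S x n = (\<Sum>c\<in>{c\<in>V. length c = n}. word_monomial d S x c)"

definition word_series :: "nat \<Rightarrow> nat list set \<Rightarrow> nat set \<Rightarrow> (nat \<Rightarrow> real) \<Rightarrow> real" where
  "word_series d V S x = (\<Sum>n. word_level d V S x n)"

lemma finite_words_of_length:
  fixes d :: nat
  assumes "V \<subseteq> lists {1..d}"
  shows "finite {c\<in>V. length c = n}"
  by (rule finite_subset[OF _ finite_lists_length_eq[OF finite_atLeastAtMost[of 1 d], of n]])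
     (use assms in auto)

lemma card_words_of_length_le:
  fixes d :: nat
  assumes "V \<subseteq> lists {1..d}"
  shows "card {c\<in>V. length c = n} \<le> d ^ n"
proof -
  have "card {c\<in>V. length c = n} \<le> card {c. set c \<subseteq> {1..d} \<and> length c = n}"
    by (rule card_mono[OF finite_lists_length_eq[OF finite_atLeastAtMost]]) (use assms in auto)
  then show ?thesis
    by (simp add: card_lists_length_eq)
qed

section \<open>Convergence\<close>

lemma power_div_fact_le_exp:
  fixes u :: real
  assumes "u \<ge> 0"
  shows "u ^ k / fact k \<le> exp u"
proof -
  have "(\<Sum>n\<in>{k}. u ^ n /\<^sub>R fact n) \<le> (\<Sum>n. u ^ n /\<^sub>R fact n)"
    by (rule sum_le_suminf[OF summable_exp_generic]) (use assms in auto)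
  then show ?thesis
    by (simp add: exp_def field_simps)
qed

text \<open>
  The factorial beats every geometric decay rate \<open>\<epsilon>\<close>, by
  \<open>R\<^sup>m / m! = \<epsilon>\<^sup>m (R/\<epsilon>)\<^sup>m / m! \<le> \<epsilon>\<^sup>m e\<^sup>R\<^sup>/\<^sup>\<epsilon>\<close>.
  The exponent \<open>m\<close> is as small as \<open>k - 2\<close>, once because of the shift in \<open>cm_factor\<close> and once because
  of a derivative; this costs \<open>\<epsilon>\<^sup>2\<close> in the denominator.
\<close>

lemma abs_cm_factor_le:
  assumes "0 < \<epsilon>" "\<epsilon> \<le> 1" "\<bar>t\<bar> \<le> R" "k \<le> k' + 1"
  shows "\<bar>cm_factor t k'\<bar> \<le> exp (R / \<epsilon>) / \<epsilon>\<^sup>2 * \<epsilon> ^ k"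
proof (cases k')
  case 0
  then show ?thesis
    using assms by (simp add: cm_factor_def)
next
  case (Suc m)
  have R: "R \<ge> 0"
    using assms(3) by linarith
  have "\<bar>cm_factor t k'\<bar> = \<bar>t\<bar> ^ m / fact m"
    by (simp add: Suc cm_factor_def power_abs)
  also have "\<dots> \<le> R ^ m / fact m"
    by (intro divide_right_mono power_mono) (use assms in auto)
  also have "\<dots> = \<epsilon> ^ m * ((R / \<epsilon>) ^ m / fact m)"
    using assms(1) by (simp add: power_divide)
  also have "\<dots> \<le> \<epsilon> ^ m * exp (R / \<epsilon>)"
    by (intro mult_left_mono power_div_fact_le_exp) (use assms R in auto)
  also have "\<epsilon> ^ m * exp (R / \<epsilon>) = exp (R / \<epsilon>) / \<epsilon>\<^sup>2 * \<epsilon> ^ (m + 2)"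
    using assms(1) by (simp add: power_add power2_eq_square)
  also have "\<dots> \<le> exp (R / \<epsilon>) / \<epsilon>\<^sup>2 * \<epsilon> ^ k"
    by (intro mult_left_mono power_decreasing) (use assms Suc in auto)
  finally show ?thesis .
qed

text \<open>
  With decay rate \<open>\<epsilon> = 1 / (2d)\<close> in each variable, the monomial of a word of length \<open>n\<close> is
  \<open>O((2d)\<^sup>-\<^sup>n)\<close>, which absorbs the number \<open>d\<^sup>n\<close> of words and leaves \<open>2\<^sup>-\<^sup>n\<close>.
\<close>

lemma word_level_bound:
  assumes V: "V \<subseteq> lists {1..d}" and d: "d \<ge> 1"
  obtains C where
    "\<And>y n. (\<forall>i\<in>{1..d}. \<bar>y i\<bar> \<le> R) \<Longrightarrow> \<bar>word_level d V S y n\<bar> \<le> C * (1 / 2) ^ n"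
proof
  define \<epsilon> :: real where "\<epsilon> = 1 / (2 * d)"
  define K where "K = exp (R / \<epsilon>) / \<epsilon>\<^sup>2"
  have \<epsilon>: "0 < \<epsilon>" "\<epsilon> \<le> 1"
    using d by (auto simp: \<epsilon>_def field_simps)
  have K: "K \<ge> 0"
    by (simp add: K_def)
  fix y :: "nat \<Rightarrow> real" and n
  assume y: "\<forall>i\<in>{1..d}. \<bar>y i\<bar> \<le> R"
  have monomial: "\<bar>word_monomial d S y c\<bar> \<le> K ^ d * \<epsilon> ^ n" if c: "c \<in> {c\<in>V. length c = n}" for c
  proof -
    have "\<bar>word_monomial d S y c\<bar>
        = (\<Prod>i=1..d. \<bar>cm_factor (y i) (count_list c i - of_bool (i \<in> S))\<bar>)"
      by (simp add: word_monomial_def abs_prod)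
    also have "\<dots> \<le> (\<Prod>i=1..d. K * \<epsilon> ^ count_list c i)"
      unfolding K_def by (intro prod_mono conjI abs_cm_factor_le \<epsilon>) (use y in auto)
    also have "\<dots> = K ^ d * \<epsilon> ^ (\<Sum>i=1..d. count_list c i)"
      by (simp add: prod.distrib power_sum)
    also have "(\<Sum>i=1..d. count_list c i) = n"
      using V c by (subst sum_count_set) auto
    finally show ?thesis .
  qed
  have "\<bar>word_level d V S y n\<bar> \<le> (\<Sum>c\<in>{c\<in>V. length c = n}. \<bar>word_monomial d S y c\<bar>)"
    unfolding word_level_def by (rule sum_abs)
  also have "\<dots> \<le> real (card {c\<in>V. length c = n}) * (K ^ d * \<epsilon> ^ n)"
    by (rule sum_bounded_above) (rule monomial)
  also have "\<dots> \<le> real (d ^ n) * (K ^ d * \<epsilon> ^ n)"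
    using K \<epsilon> card_words_of_length_le[OF V, of n]
    by (intro mult_right_mono) (simp_all only: of_nat_le_iff, simp)
  also have "\<dots> = K ^ d * (1 / 2) ^ n"
    using d by (simp add: \<epsilon>_def power_divide power_mult_distrib)
  finally show "\<bar>word_level d V S y n\<bar> \<le> K ^ d * (1 / 2) ^ n" .
qed

lemma summable_word_level:
  assumes "V \<subseteq> lists {1..d}" "d \<ge> 1"
  shows "summable (word_level d V S x)"
proof -
  have bounded: "\<forall>i\<in>{1..d}. \<bar>x i\<bar> \<le> (\<Sum>i=1..d. \<bar>x i\<bar>)"
    by (auto intro: member_le_sum)
  obtain C where C: "\<And>y n. (\<forall>i\<in>{1..d}. \<bar>y i\<bar> \<le> (\<Sum>i=1..d. \<bar>x i\<bar>)) \<Longrightarrow>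
      \<bar>word_level d V S y n\<bar> \<le> C * (1 / 2) ^ n"
    by (rule word_level_bound[OF assms]) blast
  have "summable (\<lambda>n. C * (1 / 2) ^ n)"
    by (auto intro: summable_mult summable_geometric)
  moreover have "norm (word_level d V S x n) \<le> C * (1 / 2) ^ n" if "n \<ge> 0" for n
    unfolding real_norm_def by (rule C) (rule bounded)
  ultimately show ?thesis
    by (rule summable_comparison_test')
qed

section \<open>Termwise differentiation\<close>

lemma has_field_derivative_cm_factor:
  "((\<lambda>t. cm_factor t k) has_field_derivative cm_factor t (k - 1)) (at t within A)"
proof -
  consider "k = 0" | "k = 1" | m where "k = Suc (Suc m)"
    by (metis One_nat_def not0_implies_Suc)
  then show ?thesis
  proof cases
    case 3
    have "((\<lambda>t. t ^ Suc m / fact (Suc m)) has_field_derivative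
        real (Suc m) * t ^ m / fact (Suc m)) (at t within A)"
      by (rule DERIV_cdivide) (use DERIV_pow[of "Suc m"] in simp)
    moreover have "real (Suc m) * t ^ m / fact (Suc m) = t ^ m / fact m"
      by (simp del: of_nat_Suc)
    ultimately show ?thesis
      by (simp add: 3 cm_factor_def del: fact_Suc power_Suc)
  qed (simp_all add: cm_factor_def)
qed

lemma word_monomial_fun_upd:
  assumes "j \<in> {1..d}"
  shows "word_monomial d S (x(j := t)) c =
    cm_factor t (count_list c j - of_bool (j \<in> S)) *
    (\<Prod>i\<in>{1..d} - {j}. cm_factor (x i) (count_list c i - of_bool (i \<in> S)))"
  unfolding word_monomial_def using assms by (subst prod.remove[of _ j]) simp_all

lemma has_field_derivative_word_monomial:
  assumes j: "j \<in> {1..d}" "j \<notin> S"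
  shows "((\<lambda>t. word_monomial d S (x(j := t)) c) has_field_derivative
    word_monomial d (insert j S) (x(j := t)) c) (at t within A)"
proof -
  define P where
    "P S' = (\<Prod>i\<in>{1..d} - {j}. cm_factor (x i) (count_list c i - of_bool (i \<in> S')))" for S'
  have monomial: "word_monomial d S' (x(j := u)) c =
      cm_factor u (count_list c j - of_bool (j \<in> S')) * P S'" for S' u
    unfolding P_def by (rule word_monomial_fun_upd[OF j(1)])
  have P: "P (insert j S) = P S"
    unfolding P_def by (rule prod.cong) auto
  have "((\<lambda>t. cm_factor t (count_list c j) * P S) has_field_derivative
      cm_factor t (count_list c j - 1) * P S) (at t within A)"
    by (rule DERIV_cmult_right[OF has_field_derivative_cm_factor])
  then show ?thesis
    unfolding monomial P using j(2) by simp
qed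

text \<open>
  The differentiated levels satisfy the geometric bound uniformly in a neighbourhood of the point,
  so the Weierstrass test permits differentiation level by level.
\<close>

lemma has_field_derivative_word_series:
  assumes V: "V \<subseteq> lists {1..d}" and j: "j \<in> {1..d}" "j \<notin> S"
  shows "((\<lambda>t. word_series d V S (x(j := t))) has_field_derivative
    word_series d V (insert j S) x) (at (x j))"
proof -
  have d: "d \<ge> 1"
    using j by simp
  \<comment> \<open>The summand \<open>1\<close> leaves room for the \<open>j\<close>-th coordinate to move in a unit ball.\<close>
  define R where "R = (\<Sum>i=1..d. \<bar>x i\<bar>) + 1"
  have le: "\<bar>x i\<bar> \<le> R - 1" if "i \<in> {1..d}" for i
    using that by (auto simp: R_def intro: member_le_sum)
  have bounded: "\<bar>(x(j := t)) i\<bar> \<le> R" if "t \<in> ball (x j) 1" "i \<in> {1..d}" for t i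
  proof (cases "i = j")
    case True
    then show ?thesis
      using le[OF j(1)] that(1) by (simp add: dist_real_def abs_diff_less_iff) linarith
  next
    case False
    then show ?thesis
      using le[OF that(2)] by simp
  qed
  obtain C where C: "\<And>y n. (\<forall>i\<in>{1..d}. \<bar>y i\<bar> \<le> R) \<Longrightarrow>
      \<bar>word_level d V (insert j S) y n\<bar> \<le> C * (1 / 2) ^ n"
    by (rule word_level_bound[OF V d]) blast
  have unif: "uniformly_convergent_on (ball (x j) 1)
      (\<lambda>n t. \<Sum>k<n. word_level d V (insert j S) (x(j := t)) k)"
  proof (rule Weierstrass_m_test'[of _ _ "\<lambda>n. C * (1 / 2) ^ n"])
    show "norm (word_level d V (insert j S) (x(j := t)) n) \<le> C * (1 / 2) ^ n"
      if "t \<in> ball (x j) 1" for n t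
      unfolding real_norm_def by (rule C) (intro ballI bounded that)
  qed (auto intro: summable_mult summable_geometric)
  have deriv: "((\<lambda>t. word_level d V S (x(j := t)) n) has_field_derivative
      word_level d V (insert j S) (x(j := t)) n) (at t within ball (x j) 1)" for n t
    unfolding word_level_def
    by (rule DERIV_sum) (rule has_field_derivative_word_monomial[OF j])
  have summable: "summable (\<lambda>n. word_level d V S (x(j := x j)) n)"
    by (rule summable_word_level[OF V d])
  have "((\<lambda>t. \<Sum>n. word_level d V S (x(j := t)) n) has_field_derivative
      (\<Sum>n. word_level d V (insert j S) (x(j := x j)) n)) (at (x j))"
    by (rule has_field_derivative_series'(2)[OF convex_ball deriv unif _ summable]) simp_all
  then show ?thesis
    by (simp add: word_series_def)
qed

section \<open>Products of the operators\<close>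

lemma sum_Pow_insert:
  fixes f :: "'a set \<Rightarrow> 'b::comm_monoid_add"
  assumes "finite J" "j \<notin> J"
  shows "(\<Sum>S\<in>Pow (insert j J). f S) = (\<Sum>S\<in>Pow J. f S + f (insert j S))"
proof -
  have "inj_on (insert j) (Pow J)"
    by (rule inj_onI) (use assms(2) in \<open>metis Pow_iff insert_ident subsetD\<close>)
  then have reindex: "(\<Sum>S\<in>insert j ` Pow J. f S) = (\<Sum>S\<in>Pow J. f (insert j S))"
    by (simp add: sum.reindex)
  have "(\<Sum>S\<in>Pow (insert j J). f S) = (\<Sum>S\<in>Pow J. f S) + (\<Sum>S\<in>insert j ` Pow J. f S)"
    unfolding Pow_insert by (rule sum.union_disjoint) (use assms in auto)
  then show ?thesis
    by (simp add: reindex sum.distrib)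
qed

lemma has_field_derivative_sum_word_series:
  assumes "V \<subseteq> lists {1..d}" "j \<in> {1..d}" "j \<notin> J"
  shows "((\<lambda>t. \<Sum>S\<in>Pow J. word_series d V S (x(j := t))) has_field_derivative
    (\<Sum>S\<in>Pow J. word_series d V (insert j S) x)) (at (x j))"
  by (rule DERIV_sum, rule has_field_derivative_word_series) (use assms in auto)

text \<open>
  The operator \<open>1 + \<partial>/\<partial>x\<^sub>j\<close> keeps each term and adds a copy with \<open>j\<close> put into its index set. As the
  operators involve distinct variables, no variable is ever differentiated twice, and sets suffice as indices.
\<close>

lemma foldr_one_plus_partial_word_series:
  assumes V: "V \<subseteq> lists {1..d}" and "distinct js" "set js \<subseteq> {1..d}"
  shows "foldr one_plus_partial js (word_series d V {}) =
    (\<lambda>x. \<Sum>S\<in>Pow (set js). word_series d V S x)"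
  using assms(2,3)
proof (induction js)
  case Nil
  then show ?case by simp
next
  case (Cons j js)
  have "partial_deriv j (\<lambda>x. \<Sum>S\<in>Pow (set js). word_series d V S x) x =
      (\<Sum>S\<in>Pow (set js). word_series d V (insert j S) x)" for x
    unfolding partial_deriv_def
    by (rule DERIV_imp_deriv, rule has_field_derivative_sum_word_series[OF V])
       (use Cons.prems in auto)
  then show ?case
    using Cons by (simp add: one_plus_partial_def sum_Pow_insert sum.distrib)
qed

lemma prod_one_plus_partial_word_series:
  assumes "V \<subseteq> lists {1..d}" "J \<subseteq> {1..d}"
  shows "prod_one_plus_partial J (word_series d V {}) = (\<lambda>x. \<Sum>S\<in>Pow J. word_series d V S x)"
proof -
  have "finite J"
    using assms(2) finite_subset by blast
  then show ?thesis
    using foldr_one_plus_partial_word_series[OF assms(1), of "sorted_list_of_set J"] assms(2)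
    by (simp add: prod_one_plus_partial_def)
qed

section \<open>Smirnov words by first letter\<close>

definition all_smirnov_words :: "nat \<Rightarrow> nat list set" where
  "all_smirnov_words d = {c. set c \<subseteq> {1..d} \<and> distinct_adj c}"

definition smirnov_words_from :: "nat \<Rightarrow> nat \<Rightarrow> nat list set" where
  "smirnov_words_from d i = {c \<in> all_smirnov_words d. c \<noteq> [] \<and> hd c = i}"

lemma all_smirnov_words_subset_lists: "all_smirnov_words d \<subseteq> lists {1..d}"
  by (auto simp: all_smirnov_words_def)

lemma smirnov_words_from_subset: "smirnov_words_from d i \<subseteq> all_smirnov_words d"
  by (auto simp: smirnov_words_from_def)

lemma smirnov_words_from_subset_lists: "smirnov_words_from d i \<subseteq> lists {1..d}"
  using smirnov_words_from_subset all_smirnov_words_subset_lists by (rule subset_trans)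

lemma word_level_all_smirnov_words: "word_level d (all_smirnov_words d) {} = cm_level d"
proof -
  have "{c \<in> all_smirnov_words d. length c = n} = smirnov_words n d" for n
    by (auto simp: all_smirnov_words_def smirnov_words_def)
  then show ?thesis
    by (intro ext) (simp add: word_level_def word_monomial_def cm_level_def)
qed

lemma word_series_all_smirnov_words:
  "word_series d (all_smirnov_words d) {} = continuous_multinomial d"
  by (intro ext)
     (simp add: word_series_def continuous_multinomial_def word_level_all_smirnov_words)

lemma word_level_diff:
  assumes "U \<subseteq> V" "V \<subseteq> lists {1..d}"
  shows "word_level d V S x n = word_level d U S x n + word_level d (V - U) S x n"
proof -
  have "{c\<in>V. length c = n} = {c\<in>U. length c = n} \<union> {c\<in>V - U. length c = n}"
    using assms(1) by auto
  then show ?thesis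
    unfolding word_level_def
    by (simp only:, intro sum.union_disjoint finite_words_of_length[of _ d]) (use assms in auto)
qed

lemma word_level_sum_smirnov_words_from:
  assumes "d \<ge> 1"
  shows "word_level d (all_smirnov_words d) S x n =
    (\<Sum>i=1..d. word_level d (smirnov_words_from d i) S x n)"
proof (cases n)
  case 0
  \<comment> \<open>The empty word has no first letter, but its monomial has a factor \<open>0\<close> because \<open>d \<ge> 1\<close>.\<close>
  have "word_monomial d S x [] = 0"
    using assms by (auto simp: word_monomial_def cm_factor_def)
  then have "word_level d V S x 0 = 0" for V
    unfolding word_level_def by (intro sum.neutral) auto
  then show ?thesis
    by (simp add: 0)
next
  case (Suc m)
  have "{c \<in> all_smirnov_words d. length c = n} =
      (\<Union>i\<in>{1..d}. {c \<in> smirnov_words_from d i. length c = n})" (is "?L = ?R")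
  proof
    show "?L \<subseteq> ?R"
    proof
      fix c assume c: "c \<in> ?L"
      then have "c \<noteq> []"
        using Suc by auto
      then have "hd c \<in> {1..d}"
        using c hd_in_set[of c] unfolding all_smirnov_words_def by blast
      then show "c \<in> ?R"
        using c \<open>c \<noteq> []\<close> by (auto simp: smirnov_words_from_def)
    qed
  qed (auto simp: smirnov_words_from_def)
  then show ?thesis
    unfolding word_level_def
    by (simp only:, intro sum.UNION_disjoint ballI impI finite_atLeastAtMost
          finite_words_of_length[OF smirnov_words_from_subset_lists])
       (auto simp: smirnov_words_from_def)
qed

lemma word_series_sum_smirnov_words_from:
  assumes "d \<ge> 1"
  shows "word_series d (all_smirnov_words d) S x =
    (\<Sum>i=1..d. word_series d (smirnov_words_from d i) S x)"
  unfolding word_series_def word_level_sum_smirnov_words_from[OF assms]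
  by (rule suminf_sum) (intro summable_word_level smirnov_words_from_subset_lists assms)

text \<open>
  Deleting the initial letter \<open>i\<close> maps the words beginning with \<open>i\<close> onto the words that do not begin
  with \<open>i\<close>, and it undoes the shift of the count of \<open>i\<close> that comes with the derivative.
\<close>

lemma word_level_smirnov_words_from_Suc:
  assumes i: "i \<in> {1..d}" "i \<notin> S"
  shows "word_level d (smirnov_words_from d i) (insert i S) x (Suc n) =
    word_level d (all_smirnov_words d - smirnov_words_from d i) S x n"
proof -
  have words: "{c \<in> smirnov_words_from d i. length c = Suc n} =
      (#) i ` {c \<in> all_smirnov_words d - smirnov_words_from d i. length c = n}"
    using i(1)
    by (auto simp: smirnov_words_from_def all_smirnov_words_def length_Suc_conv distinct_adj_Cons
          image_iff)
  have "word_monomial d (insert i S) x (i # c) = word_monomial d S x c" for c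
    unfolding word_monomial_def by (rule prod.cong) (use i(2) in auto)
  then show ?thesis
    unfolding word_level_def words by (simp add: sum.reindex)
qed

text \<open>This is \<open>(1 + \<partial>/\<partial>x\<^sub>i) F\<^sub>i = F\<close>, differentiated once in each variable indexed by \<open>S\<close>.\<close>

lemma word_series_starting_with:
  assumes i: "i \<in> {1..d}" "i \<notin> S"
  shows "word_series d (smirnov_words_from d i) S x +
      word_series d (smirnov_words_from d i) (insert i S) x =
    word_series d (all_smirnov_words d) S x"
proof -
  have d: "d \<ge> 1"
    using i by simp
  let ?V = "all_smirnov_words d" and ?U = "smirnov_words_from d i"
  have zero: "word_level d ?U (insert i S) x 0 = 0"
    by (auto simp: word_level_def smirnov_words_from_def intro!: sum.neutral)
  have "word_series d ?U (insert i S) x = (\<Sum>n. word_level d ?U (insert i S) x (Suc n))"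
    unfolding word_series_def
    using suminf_split_head[OF summable_word_level[OF smirnov_words_from_subset_lists d]] zero
    by simp
  also have "\<dots> = word_series d (?V - ?U) S x"
    unfolding word_series_def word_level_smirnov_words_from_Suc[OF i] ..
  finally have deleted: "word_series d ?U (insert i S) x = word_series d (?V - ?U) S x" .
  have rest: "?V - ?U \<subseteq> lists {1..d}"
    using all_smirnov_words_subset_lists by blast
  have "word_series d ?V S x = word_series d ?U S x + word_series d (?V - ?U) S x"
    unfolding word_series_def
      word_level_diff[OF smirnov_words_from_subset[of d i] all_smirnov_words_subset_lists]
    by (rule suminf_add[symmetric])
       (intro summable_word_level smirnov_words_from_subset_lists rest d)+
  then show ?thesis
    by (simp add: deleted)
qed

section \<open>The differential equation\<close>

theorem theorem2:
  fixes d :: nat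
  assumes "d \<ge> 1"
  shows "(\<forall>x. summable (cm_level d x)) \<and>
         (\<forall>J j. J \<subseteq> {1..d} \<and> j \<in> {1..d} - J \<longrightarrow>
            partially_differentiable j (prod_one_plus_partial J (continuous_multinomial d))) \<and>
         (\<forall>x. prod_one_plus_partial {1..d} (continuous_multinomial d) x =
            (\<Sum>i=1..d. prod_one_plus_partial ({1..d} - {i}) (continuous_multinomial d) x))"
proof (intro conjI allI impI)
  let ?V = "all_smirnov_words d"
  let ?U = "smirnov_words_from d"
  note V = all_smirnov_words_subset_lists
  have expand: "prod_one_plus_partial J (continuous_multinomial d) =
      (\<lambda>x. \<Sum>S\<in>Pow J. word_series d ?V S x)" if "J \<subseteq> {1..d}" for J
    using prod_one_plus_partial_word_series[OF V that]
    by (simp add: word_series_all_smirnov_words)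
  show "summable (cm_level d x)" for x
    using summable_word_level[OF V assms] by (metis word_level_all_smirnov_words)
  show "partially_differentiable j (prod_one_plus_partial J (continuous_multinomial d))"
    if "J \<subseteq> {1..d} \<and> j \<in> {1..d} - J" for J j
    unfolding partially_differentiable_def field_differentiable_def
    using that has_field_derivative_sum_word_series[OF V, of j d J] by (auto simp: expand)
  show "prod_one_plus_partial {1..d} (continuous_multinomial d) x =
      (\<Sum>i=1..d. prod_one_plus_partial ({1..d} - {i}) (continuous_multinomial d) x)" for x
  proof -
    have "prod_one_plus_partial {1..d} (continuous_multinomial d) x =
        (\<Sum>S\<in>Pow {1..d}. \<Sum>i=1..d. word_series d (?U i) S x)"
      by (simp add: expand word_series_sum_smirnov_words_from[OF assms])
    also have "\<dots> = (\<Sum>i=1..d. \<Sum>S\<in>Pow {1..d}. word_series d (?U i) S x)"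
      by (rule sum.swap)
    also have "\<dots> = (\<Sum>i=1..d. \<Sum>S\<in>Pow ({1..d} - {i}). word_series d ?V S x)"
    proof (rule sum.cong[OF refl])
      fix i assume i: "i \<in> {1..d}"
      \<comment> \<open>Splitting off the operator for \<open>i\<close> pairs \<open>S\<close> with \<open>insert i S\<close>, and each pair of
          series for words from \<open>i\<close> merges into the series for all words.\<close>
      have "(\<Sum>S\<in>Pow {1..d}. word_series d (?U i) S x) =
          (\<Sum>S\<in>Pow (insert i ({1..d} - {i})). word_series d (?U i) S x)"
        using i by (simp add: insert_absorb)
      also have "\<dots> = (\<Sum>S\<in>Pow ({1..d} - {i}).
          word_series d (?U i) S x + word_series d (?U i) (insert i S) x)"
        by (rule sum_Pow_insert) auto
      also have "\<dots> = (\<Sum>S\<in>Pow ({1..d} - {i}). word_series d ?V S x)"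
        by (intro sum.cong refl word_series_starting_with i) auto
      finally show "(\<Sum>S\<in>Pow {1..d}. word_series d (?U i) S x) =
          (\<Sum>S\<in>Pow ({1..d} - {i}). word_series d ?V S x)" .
    qed
    also have "\<dots> = (\<Sum>i=1..d. prod_one_plus_partial ({1..d} - {i}) (continuous_multinomial d) x)"
      by (simp add: expand)
    finally show ?thesis .
  qed
qed

end
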